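(* Let $P=\frac1{100}P_1+\frac{99}{100}P_2$, where $P_1$ and $P_2$ are the uniform distributions on $[0,\frac13]$ and $[\frac23,1]$, respectively. The optimal set of two-means for $P$ is $\{0.731517,\ 0.910506\}$ with quantization error $V_2=0.005682$, where the displayed decimals are roundings of exact real values; that is, the optimal set of two-means is $\{a_1<a_2\}$ where $a_1,a_2$ rounded to six decimal places are $0.731517$ and $0.910506$, and $V_2$ rounded to six decimal places is $0.005682$.
   Context: For a Borel probability measure $P$ on $\mathbb{R}$ and $n\in\mathbb{N}$, the $n$th quantization error is $V_n=V_n(P)=\inf\{\int\min_{a\in\alpha}(x-a)^2\,dP(x) : \alpha\subset\mathbb{R},\ 1\le\mathrm{card}(\alpha)\le n\}$, and an optimal set of $n$-means for $P$ is a set $\alpha$ with $1\le\mathrm{card}(\alpha)\le n$ attaining this infimum. *)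

theory Defs
  imports "HOL-Analysis.Analysis"
begin

definition mixture :: "real \<Rightarrow> 'a measure \<Rightarrow> 'a measure \<Rightarrow> 'a measure" where
  "mixture p M N = measure_of (space M) (sets M)
     (\<lambda>A. ennreal p * emeasure M A + ennreal (1 - p) * emeasure N A)"

lemma space_mixture [simp]: "space (mixture p M N) = space M"
  by (simp add: mixture_def)

lemma sets_mixture [simp]: "sets (mixture p M N) = sets M"
  by (simp add: mixture_def)

(* measure_of silently yields the null measure unless the given set function is
   countably additive; the next lemma shows that this is the case here. *)
lemma emeasure_mixture:
  assumes "sets M = sets N" and "A \<in> sets M"
  shows "emeasure (mixture p M N) A = ennreal p * emeasure M A + ennreal (1 - p) * emeasure N A"
proof (rule emeasure_measure_of[OF mixture_def])
  show "countably_additive (sets (mixture p M N))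
          (\<lambda>A. ennreal p * emeasure M A + ennreal (1 - p) * emeasure N A)"
  proof (rule countably_additiveI)
    fix A :: "nat \<Rightarrow> 'a set"
    assume "range A \<subseteq> sets (mixture p M N)" and "disjoint_family A"
    then have "(\<Sum>i. emeasure M (A i)) = emeasure M (\<Union>i. A i)"
      and "(\<Sum>i. emeasure N (A i)) = emeasure N (\<Union>i. A i)"
      using assms(1) by (auto intro!: suminf_emeasure)
    then show "(\<Sum>i. ennreal p * emeasure M (A i) + ennreal (1 - p) * emeasure N (A i))
        = ennreal p * emeasure M (\<Union>i. A i) + ennreal (1 - p) * emeasure N (\<Union>i. A i)"
      by (simp add: suminf_add[symmetric])
  qed
qed (use assms in \<open>auto simp: positive_def dest: sets.sets_into_space\<close>)

(* The integral is taken in ennreal, so that it is infinite (rather than 0) when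
   the squared distance is not integrable. *)
definition distortion :: "real measure \<Rightarrow> real set \<Rightarrow> ennreal" where
  "distortion P \<alpha> = (\<integral>\<^sup>+ x. ennreal (Min ((\<lambda>a. (x - a)\<^sup>2) ` \<alpha>)) \<partial>P)"

definition quantization_error :: "nat \<Rightarrow> real measure \<Rightarrow> ennreal" where
  "quantization_error n P =
     (INF \<alpha> \<in> {\<alpha>. finite \<alpha> \<and> 1 \<le> card \<alpha> \<and> card \<alpha> \<le> n}. distortion P \<alpha>)"

definition optimal_set_of_means :: "nat \<Rightarrow> real measure \<Rightarrow> real set \<Rightarrow> bool" where
  "optimal_set_of_means n P \<alpha> \<longleftrightarrow>
     finite \<alpha> \<and> 1 \<le> card \<alpha> \<and> card \<alpha> \<le> n \<and> distortion P \<alpha> = quantization_error n P"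

definition P1 :: "real measure" where
  "P1 = uniform_measure lborel {0..1/3}"

definition P2 :: "real measure" where
  "P2 = uniform_measure lborel {2/3..1}"

definition Pmix :: "real measure" where
  "Pmix = mixture (1/100) P1 P2"

end

theory Submission
  imports Defs
begin

text \<open>
  The measure has density \<open>3/100\<close> on \<open>[0, 1/3]\<close> and \<open>297/100\<close> on \<open>[2/3, 1]\<close>. Two points
  \<open>a \<le> b\<close> divide the line at their midpoint, and almost all of the mass lies in \<open>[2/3, 1]\<close>, so
  a good pair has to divide that interval.

  Suppose first that the midpoint lies in \<open>[2/3, 1]\<close>. Then the distortion is a cubic polynomial in
  \<open>a\<close> and \<open>b\<close> (\<open>distortion_split\<close>), and it can be minimised one variable at a time without any
  calculus. For fixed \<open>a\<close> the best \<open>b\<close> is \<open>(a + 2) / 3\<close>, and the excess of any other choice is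
  a square times a positive factor. What remains is a cubic in \<open>a\<close> alone, whose local minimum is at
  \<open>t = (41 + sqrt 53) / 66\<close>; its excess over the value at \<open>t\<close> is \<open>(a - t)\<^sup>2\<close> times a factor that
  is positive for \<open>a > 1/2\<close>. Adding both excesses (\<open>split_cost_eq_left_cost\<close>,
  \<open>left_cost_gap\<close>) shows that the pair \<open>t\<close>, \<open>(t + 2) / 3\<close> is the only minimiser among these
  pairs with \<open>a > 1/2\<close>.

  All other pairs are far from optimal (\<open>distortion_unsplit\<close>). If the midpoint lies outside
  \<open>(2/3, 1)\<close>, a single point serves all of \<open>[2/3, 1]\<close>, which costs at least
  \<open>297/100 * 1/324 = 11/1200\<close>, more than \<open>0.009\<close>. If \<open>a \<le> 1/2\<close>, moving \<open>a\<close> up to \<open>1/2\<close> only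
  lowers the cost on \<open>[2/3, 1]\<close>, and with \<open>a = 1/2\<close> the same bound holds. The optimal value is
  \<open>(317 - 318 t) / 14850\<close>, about \<open>0.00568\<close>.
\<close>

section \<open>Integration against a mixture\<close>

lemma nn_integral_mixture:
  assumes sets_eq: "sets M = sets N" and f: "f \<in> borel_measurable M"
  shows "(\<integral>\<^sup>+ x. f x \<partial>mixture p M N)
       = ennreal p * (\<integral>\<^sup>+ x. f x \<partial>M) + ennreal (1 - p) * (\<integral>\<^sup>+ x. f x \<partial>N)"
proof -
  have meas: "g \<in> borel_measurable (mixture p M N)" "g \<in> borel_measurable N"
    if "g \<in> borel_measurable M" for g :: "'a \<Rightarrow> ennreal"
    using that by (simp_all cong: measurable_cong_sets flip: sets_eq)
  show ?thesis
    using f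
  proof (induction rule: borel_measurable_induct)
    case (cong f g)
    have "(\<integral>\<^sup>+ x. f x \<partial>K) = (\<integral>\<^sup>+ x. g x \<partial>K)" if "space K = space M" for K
      using cong that by (intro nn_integral_cong) auto
    then show ?case
      using cong sets_eq_imp_space_eq[OF sets_eq] by simp
  next
    case (set A)
    then have "A \<in> sets N" using sets_eq by simp
    then show ?case
      using set by (simp add: emeasure_mixture[OF sets_eq])
  next
    case (mult u c)
    then show ?case
      by (simp add: nn_integral_cmult meas distrib_left mult.left_commute)
  next
    case (add u v)
    then show ?case
      by (simp add: nn_integral_add meas distrib_left add_ac)
  next
    case (seq U)
    have incs: "incseq (\<lambda>i. ennreal c * (\<integral>\<^sup>+ x. U i x \<partial>K))" for c K
      using \<open>incseq U\<close>
      by (auto simp: incseq_def le_fun_def intro!: mult_left_mono nn_integral_mono)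
    have SUP: "(\<integral>\<^sup>+ x. (SUP i. U i x) \<partial>K) = (SUP i. \<integral>\<^sup>+ x. U i x \<partial>K)"
      if "\<And>i. U i \<in> borel_measurable K" for K
      using \<open>incseq U\<close> that by (rule nn_integral_monotone_convergence_SUP)
    have "(\<integral>\<^sup>+ x. (SUP i. U i x) \<partial>mixture p M N) = (SUP i. \<integral>\<^sup>+ x. U i x \<partial>mixture p M N)"
      using seq(1) by (intro SUP meas)
    also have "\<dots> = (SUP i. ennreal p * (\<integral>\<^sup>+ x. U i x \<partial>M) + ennreal (1 - p) * (\<integral>\<^sup>+ x. U i x \<partial>N))"
      by (simp only: seq)
    also have "\<dots> = ennreal p * (SUP i. \<integral>\<^sup>+ x. U i x \<partial>M) + ennreal (1 - p) * (SUP i. \<integral>\<^sup>+ x. U i x \<partial>N)"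
      by (simp only: SUP_mult_left_ennreal ennreal_SUP_add incs)
    also have "(SUP i. \<integral>\<^sup>+ x. U i x \<partial>M) = (\<integral>\<^sup>+ x. (SUP i. U i x) \<partial>M)"
      using seq(1) by (intro SUP[symmetric])
    also have "(SUP i. \<integral>\<^sup>+ x. U i x \<partial>N) = (\<integral>\<^sup>+ x. (SUP i. U i x) \<partial>N)"
      using seq(1) by (intro SUP[symmetric] meas)
    finally show ?case
      by (simp add: image_comp)
  qed
qed

section \<open>Squared distances integrated over an interval\<close>

lemma nn_integral_square_dist_Icc:
  fixes a l u :: real
  assumes "l \<le> u"
  shows "(\<integral>\<^sup>+ x. ennreal ((x - a)\<^sup>2) * indicator {l..u} x \<partial>lborel)
       = ennreal (((u - a) ^ 3 - (l - a) ^ 3) / 3)"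
proof -
  have "(\<integral>\<^sup>+ x. ennreal ((x - a)\<^sup>2) * indicator {l..u} x \<partial>lborel)
       = ennreal ((u - a) ^ 3 / 3 - (l - a) ^ 3 / 3)"
    by (rule nn_integral_FTC_Icc[where F = "\<lambda>x. (x - a) ^ 3 / 3"])
       (use assms in \<open>auto intro!: derivative_eq_intros simp: power2_eq_square\<close>)
  then show ?thesis by (simp add: diff_divide_distrib)
qed

text \<open>The two pieces share the endpoint \<open>m\<close>, which is a null set.\<close>

lemma nn_integral_Icc_split:
  fixes l m u :: real
  assumes [measurable]: "f \<in> borel_measurable borel" and "l \<le> m" "m \<le> u"
  shows "(\<integral>\<^sup>+ x. f x * indicator {l..u} x \<partial>lborel)
       = (\<integral>\<^sup>+ x. f x * indicator {l..m} x \<partial>lborel) + (\<integral>\<^sup>+ x. f x * indicator {m..u} x \<partial>lborel)"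
proof -
  have "(\<integral>\<^sup>+ x. f x * indicator {l..u} x \<partial>lborel)
      = (\<integral>\<^sup>+ x. f x * indicator {l..m} x + f x * indicator {m..u} x \<partial>lborel)"
  proof (rule nn_integral_cong_AE)
    show "AE x in lborel. f x * indicator {l..u} x
        = f x * indicator {l..m} x + f x * indicator {m..u} x"
      using AE_lborel_singleton[of m] by eventually_elim (use assms in \<open>auto simp: indicator_def\<close>)
  qed
  then show ?thesis by (simp add: nn_integral_add)
qed

lemma min_square_dist_left:
  fixes a b x :: real
  assumes "a \<le> b" "x \<le> (a + b) / 2"
  shows "min ((x - a)\<^sup>2) ((x - b)\<^sup>2) = (x - a)\<^sup>2"
proof -
  have "(x - b)\<^sup>2 - (x - a)\<^sup>2 = (b - a) * (a + b - 2 * x)"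
    by (simp add: power2_eq_square algebra_simps)
  also have "\<dots> \<ge> 0" using assms by simp
  finally show ?thesis by simp
qed

lemma min_square_dist_right:
  fixes a b x :: real
  assumes "a \<le> b" "(a + b) / 2 \<le> x"
  shows "min ((x - a)\<^sup>2) ((x - b)\<^sup>2) = (x - b)\<^sup>2"
proof -
  have "(x - a)\<^sup>2 - (x - b)\<^sup>2 = (b - a) * (2 * x - a - b)"
    by (simp add: power2_eq_square algebra_simps)
  also have "\<dots> \<ge> 0" using assms by simp
  finally show ?thesis by simp
qed

definition interval_cost :: "real \<Rightarrow> real \<Rightarrow> real \<Rightarrow> real \<Rightarrow> ennreal" where
  "interval_cost a b l u =
     (\<integral>\<^sup>+ x. ennreal (min ((x - a)\<^sup>2) ((x - b)\<^sup>2)) * indicator {l..u} x \<partial>lborel)"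

lemma interval_cost_left:
  assumes "a \<le> b" "l \<le> u" "u \<le> (a + b) / 2"
  shows "interval_cost a b l u = ennreal (((u - a) ^ 3 - (l - a) ^ 3) / 3)"
  unfolding interval_cost_def nn_integral_square_dist_Icc[OF assms(2), symmetric]
  using assms by (intro nn_integral_cong) (auto simp: indicator_def min_square_dist_left)

lemma interval_cost_right:
  assumes "a \<le> b" "l \<le> u" "(a + b) / 2 \<le> l"
  shows "interval_cost a b l u = ennreal (((u - b) ^ 3 - (l - b) ^ 3) / 3)"
  unfolding interval_cost_def nn_integral_square_dist_Icc[OF assms(2), symmetric]
  using assms by (intro nn_integral_cong) (auto simp: indicator_def min_square_dist_right)

text \<open>
  Cutting the interval at the midpoint of \<open>a\<close> and \<open>b\<close> leaves each point with its own piece. The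
  midpoint has distance \<open>(b - a) / 2\<close> from both points, whence the factor \<open>2\<close> in the middle term.
\<close>

lemma interval_cost_middle:
  assumes "a \<le> b" "l \<le> (a + b) / 2" "(a + b) / 2 \<le> u"
  shows "interval_cost a b l u
       = ennreal (((a - l) ^ 3 + 2 * ((b - a) / 2) ^ 3 + (u - b) ^ 3) / 3)"
proof -
  define m where "m = (a + b) / 2"
  have "interval_cost a b l u = interval_cost a b l m + interval_cost a b m u"
    unfolding interval_cost_def using assms by (intro nn_integral_Icc_split) (auto simp: m_def)
  also have "interval_cost a b l m = ennreal (((m - a) ^ 3 - (l - a) ^ 3) / 3)"
    using assms by (intro interval_cost_left) (auto simp: m_def)
  also have "interval_cost a b m u = ennreal (((u - b) ^ 3 - (m - b) ^ 3) / 3)"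
    using assms by (intro interval_cost_right) (auto simp: m_def)
  also have "ennreal (((m - a) ^ 3 - (l - a) ^ 3) / 3) + ennreal (((u - b) ^ 3 - (m - b) ^ 3) / 3)
      = ennreal (((m - a) ^ 3 - (l - a) ^ 3) / 3 + ((u - b) ^ 3 - (m - b) ^ 3) / 3)"
    using assms by (intro ennreal_plus[symmetric]) (auto simp: m_def intro!: power_mono_odd)
  also have "((m - a) ^ 3 - (l - a) ^ 3) / 3 + ((u - b) ^ 3 - (m - b) ^ 3) / 3
      = ((a - l) ^ 3 + 2 * ((b - a) / 2) ^ 3 + (u - b) ^ 3) / 3"
    by (simp add: m_def field_simps power3_eq_cube)
  finally show ?thesis .
qed

text \<open>
  A point to the left of the whole interval gets closer to every point of it when it moves right.
\<close>

lemma interval_cost_mono_left: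
  assumes "a \<le> a'" "a' \<le> l"
  shows "interval_cost a' b l u \<le> interval_cost a b l u"
  unfolding interval_cost_def
proof (intro nn_integral_mono)
  fix x
  have "(x - a')\<^sup>2 \<le> (x - a)\<^sup>2" if "x \<in> {l..u}"
    using assms that by (intro power_mono) auto
  then show "ennreal (min ((x - a')\<^sup>2) ((x - b)\<^sup>2)) * indicator {l..u} x
      \<le> ennreal (min ((x - a)\<^sup>2) ((x - b)\<^sup>2)) * indicator {l..u} x"
    by (auto simp: indicator_def intro!: ennreal_leI)
qed

section \<open>The distortion of a pair of points\<close>

lemma distortion_Pmix_pair:
  "distortion Pmix {a, b}
     = ennreal (3/100) * interval_cost a b 0 (1/3) + ennreal (297/100) * interval_cost a b (2/3) 1"
proof -
  define f where "f x = ennreal (min ((x - a)\<^sup>2) ((x - b)\<^sup>2))" for x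
  have [measurable]: "f \<in> borel_measurable borel"
    unfolding f_def by measurable
  have unif: "(\<integral>\<^sup>+ x. f x \<partial>uniform_measure lborel {l..l + 1/3}) = ennreal 3 * interval_cost a b l (l + 1/3)"
    for l
  proof -
    have "(\<integral>\<^sup>+ x. f x \<partial>uniform_measure lborel {l..l + 1/3}) = interval_cost a b l (l + 1/3) / ennreal (1/3)"
      by (subst nn_integral_uniform_measure) (auto simp: interval_cost_def f_def)
    then show ?thesis
      by (simp add: divide_ennreal_def inverse_ennreal mult.commute)
  qed
  have "distortion Pmix {a, b} = (\<integral>\<^sup>+ x. f x \<partial>Pmix)"
    by (simp add: distortion_def f_def)
  also have "\<dots> = ennreal (1/100) * (\<integral>\<^sup>+ x. f x \<partial>P1) + ennreal (1 - 1/100) * (\<integral>\<^sup>+ x. f x \<partial>P2)"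
    unfolding Pmix_def by (rule nn_integral_mixture) (auto simp: P1_def P2_def)
  also have "\<dots> = ennreal (1/100) * (ennreal 3 * interval_cost a b 0 (1/3))
      + ennreal (99/100) * (ennreal 3 * interval_cost a b (2/3) 1)"
    using unif[of 0] unif[of "2/3"] by (simp add: P1_def P2_def)
  finally show ?thesis
    by (simp add: mult.assoc[symmetric] ennreal_mult[symmetric] del: ennreal_numeral)
qed

text \<open>
  The distortion when the midpoint of \<open>a\<close> and \<open>b\<close> lies in \<open>[2/3, 1]\<close>. All of \<open>P1\<close>, with mean
  \<open>1/6\<close> and variance \<open>1/108\<close>, is then served by \<open>a\<close>; the other summand is the share of \<open>P2\<close>.
\<close>

definition split_cost :: "real \<Rightarrow> real \<Rightarrow> real" where
  "split_cost a b = 1/100 * ((a - 1/6)\<^sup>2 + 1/108)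
     + 99/100 * ((a - 2/3) ^ 3 + 2 * ((b - a) / 2) ^ 3 + (1 - b) ^ 3)"

text \<open>
  With \<open>L = 1 - a\<close> and \<open>b = a + 2 * h\<close> the left-hand side is three times the cost of the points \<open>a\<close> and
  \<open>b\<close> for the interval \<open>[a, 1]\<close>. As a cubic in \<open>h\<close> it has its local minimum at
  \<open>h = L / 3\<close>, so subtracting the value there leaves a polynomial with a double root at \<open>L / 3\<close>; the third root is then \<open>4 * L / 3\<close>, because the
  roots add up to \<open>2 * L\<close>.
\<close>

lemma cubic_gap:
  fixes L h :: real
  shows "2 * h ^ 3 + (L - 2 * h) ^ 3 = L ^ 3 / 9 + 6 * (h - L / 3)\<^sup>2 * (4 * L / 3 - h)"
  by (simp add: field_simps power3_eq_cube power2_eq_square)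

lemma distortion_split:
  assumes "a \<le> b" "4/3 \<le> a + b" "a + b \<le> 2"
  shows "distortion Pmix {a, b} = ennreal (split_cost a b)" "0 \<le> split_cost a b"
proof -
  define u v where "u = ((1/3 - a) ^ 3 - (0 - a) ^ 3) / 3"
    and "v = ((a - 2/3) ^ 3 + 2 * ((b - a) / 2) ^ 3 + (1 - b) ^ 3) / 3"
  have u: "0 \<le> u"
    unfolding u_def using power_mono_odd[of 3 "0 - a" "1/3 - a"] by simp
  \<comment> \<open>The outer cubes in \<open>v\<close> may be negative. As \<open>2/3\<close> is to the left of the midpoint and \<open>1\<close> to its
    right, each of them is outweighed by one of the two copies of the middle cube.\<close>
  have "(2/3 - a) ^ 3 \<le> ((b - a) / 2) ^ 3" "(b - 1) ^ 3 \<le> ((b - a) / 2) ^ 3"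
    using assms by (auto intro!: power_mono_odd)
  moreover have "(2/3 - a) ^ 3 = - ((a - 2/3) ^ 3)" "(b - 1) ^ 3 = - ((1 - b) ^ 3)"
    using power_minus_odd[of 3 "a - 2/3"] power_minus_odd[of 3 "1 - b"] by simp_all
  ultimately have v: "0 \<le> v"
    unfolding v_def by simp
  have uv: "3/100 * u + 297/100 * v = split_cost a b"
    by (simp add: u_def v_def split_cost_def field_simps power3_eq_cube power2_eq_square)
  have "distortion Pmix {a, b} = ennreal (3/100) * ennreal u + ennreal (297/100) * ennreal v"
    unfolding distortion_Pmix_pair u_def v_def
    using assms by (subst interval_cost_left, simp, simp, simp, subst interval_cost_middle) auto
  also have "\<dots> = ennreal (3/100 * u + 297/100 * v)"
    using u v by (simp add: ennreal_mult[symmetric] del: times_divide_eq_left)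
  finally show "distortion Pmix {a, b} = ennreal (split_cost a b)"
    using uv by simp
  show "0 \<le> split_cost a b" using u v uv by simp
qed

text \<open>
  The cost of one point for the interval \<open>[2/3, 1]\<close>, before scaling by the density, is least at the
  centre \<open>5/6\<close>, where it is \<open>(1/3) ^ 3 / 12\<close>.
\<close>

lemma single_point_cost:
  fixes c :: real
  shows "1/324 \<le> ((1 - c) ^ 3 - (2/3 - c) ^ 3) / 3"
proof -
  have "((1 - c) ^ 3 - (2/3 - c) ^ 3) / 3 = 1/324 + (c - 5/6)\<^sup>2 / 3"
    by (simp add: field_simps power3_eq_cube power2_eq_square)
  then show ?thesis by simp
qed

lemma interval_cost_unsplit:
  assumes "a \<le> b" "a + b \<le> 4/3 \<or> 2 \<le> a + b"
  shows "ennreal (1/324) \<le> interval_cost a b (2/3) 1"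
proof (cases "a + b \<le> 4/3")
  case True
  then show ?thesis
    using assms single_point_cost[of b] by (subst interval_cost_right) (auto intro!: ennreal_leI)
next
  case False
  then show ?thesis
    using assms single_point_cost[of a] by (subst interval_cost_left) (auto intro!: ennreal_leI)
qed

text \<open>
  The best partner of \<open>1/2\<close> is \<open>(1/2 + 2) / 3 = 5/6\<close>, and their midpoint is exactly \<open>2/3\<close>. This is
  why the bound for a single point reappears.
\<close>

lemma interval_cost_half:
  assumes "1/2 \<le> b"
  shows "ennreal (1/324) \<le> interval_cost (1/2) b (2/3) 1"
proof (cases "1/2 + b \<le> 4/3 \<or> 2 \<le> 1/2 + b")
  case True
  then show ?thesis
    using assms by (intro interval_cost_unsplit) auto
next
  case False
  define h where "h = (b - 1/2) / 2"
  have "2 * h ^ 3 + (1/2 - 2 * h) ^ 3 \<ge> (1/2) ^ 3 / 9"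
    unfolding cubic_gap using False by (auto simp: h_def)
  moreover have "1/2 - 2 * h = 1 - b" by (simp add: h_def field_simps)
  ultimately have "(1/2) ^ 3 / 9 \<le> 2 * h ^ 3 + (1 - b) ^ 3" by simp
  moreover have "((1/2 - 2/3) ^ 3 + (1/2) ^ 3 / 9) / 3 = (1/324 :: real)"
    by (simp add: power3_eq_cube)
  ultimately have "1/324 \<le> ((1/2 - 2/3) ^ 3 + 2 * ((b - 1/2) / 2) ^ 3 + (1 - b) ^ 3) / 3"
    unfolding h_def by (simp add: add_divide_distrib diff_divide_distrib)
  then show ?thesis
    using False assms by (subst interval_cost_middle) (auto intro!: ennreal_leI)
qed

lemma distortion_unsplit:
  assumes "a \<le> b" "a + b \<le> 4/3 \<or> 2 \<le> a + b \<or> a \<le> 1/2"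
  shows "ennreal (11/1200) \<le> distortion Pmix {a, b}"
proof -
  have "ennreal (1/324) \<le> interval_cost a b (2/3) 1"
  proof (cases "a + b \<le> 4/3 \<or> 2 \<le> a + b")
    case True
    then show ?thesis using assms by (intro interval_cost_unsplit)
  next
    case False
    then have "ennreal (1/324) \<le> interval_cost (1/2) b (2/3) 1"
      using assms by (intro interval_cost_half) auto
    also have "\<dots> \<le> interval_cost a b (2/3) 1"
      using False assms by (intro interval_cost_mono_left) auto
    finally show ?thesis .
  qed
  then have "ennreal (297/100) * ennreal (1/324) \<le> ennreal (297/100) * interval_cost a b (2/3) 1"
    by (rule mult_left_mono) simp
  also have "ennreal (297/100) * ennreal (1/324) = ennreal (11/1200)"
    by (simp add: ennreal_mult[symmetric])
  finally show ?thesis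
    unfolding distortion_Pmix_pair by (simp add: add_increasing)
qed

section \<open>The optimal pair\<close>

text \<open>The larger root of the derivative of the cubic \<open>left_cost\<close> below.\<close>

definition opt_left :: real where
  "opt_left = (41 + sqrt 53) / 66"

definition opt_right :: real where
  "opt_right = (opt_left + 2) / 3"

lemma sqrt_53_bounds: "72801098 / 10^7 < sqrt 53" "sqrt 53 < 72801099 / 10^7"
  by (rule real_less_rsqrt real_less_lsqrt; simp add: power2_eq_square)+

lemma opt_left_bounds: "7315168 / 10^7 < opt_left" "opt_left < 7315169 / 10^7"
  using sqrt_53_bounds by (auto simp: opt_left_def)

lemma opt_right_bounds: "9105055 / 10^7 < opt_right" "opt_right < 9105057 / 10^7"
  using opt_left_bounds by (auto simp: opt_right_def field_simps)

lemma opt_left_eq: "opt_left\<^sup>2 = 41/33 * opt_left - 37/99"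
  by (simp add: opt_left_def power2_eq_square field_simps)

text \<open>
  The value of \<open>split_cost a b\<close> for the best \<open>b\<close>, which is \<open>(a + 2) / 3\<close>: then
  \<open>2 * ((b - a) / 2) ^ 3 + (1 - b) ^ 3\<close> is \<open>(1 - a) ^ 3 / 9\<close> by \<open>cubic_gap\<close>.
\<close>

definition left_cost :: "real \<Rightarrow> real" where
  "left_cost a = 1/100 * ((a - 1/6)\<^sup>2 + 1/108) + 99/100 * (a - 2/3) ^ 3 + 11/100 * (1 - a) ^ 3"

lemma split_cost_eq_left_cost:
  "split_cost a b = left_cost a
     + 297/50 * ((b - a) / 2 - (1 - a) / 3)\<^sup>2 * (4 * (1 - a) / 3 - (b - a) / 2)"
proof -
  define E where "E = ((b - a) / 2 - (1 - a) / 3)\<^sup>2 * (4 * (1 - a) / 3 - (b - a) / 2)"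
  have b: "1 - a - 2 * ((b - a) / 2) = 1 - b" by (simp add: field_simps)
  have "2 * ((b - a) / 2) ^ 3 + (1 - b) ^ 3 = (1 - a) ^ 3 / 9 + 6 * E"
    using cubic_gap[of "(b - a) / 2" "1 - a"] unfolding b E_def mult.assoc .
  then have "split_cost a b = left_cost a + 297/50 * E"
    unfolding split_cost_def left_cost_def by argo
  then show ?thesis by (simp only: E_def mult.assoc)
qed

lemma split_cost_opt_eq: "split_cost opt_left opt_right = left_cost opt_left"
  by (simp add: split_cost_eq_left_cost opt_right_def field_simps)

text \<open>
  The cubic \<open>left_cost\<close> has leading coefficient \<open>22/25\<close> and a critical point at \<open>opt_left\<close>. So
  subtracting its value there leaves a double root, and the third root follows from the sum of the
  roots, which is \<open>41/22\<close>.
\<close>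

lemma left_cost_gap:
  "left_cost a = left_cost opt_left
     + 22/25 * (a - opt_left)\<^sup>2 * (a - (41/22 - 2 * opt_left))"
proof -
  define t where "t = opt_left"
  have t2: "t * t = 41/33 * t - 37/99"
    using opt_left_eq by (simp add: t_def power2_eq_square)
  have "left_cost a - left_cost t - 22/25 * (a - t)\<^sup>2 * (a - (41/22 - 2 * t))
     = 66/25 * (a - t) * (t * t - (41/33 * t - 37/99))"
    by (simp add: left_cost_def field_simps power3_eq_cube power2_eq_square)
  then show ?thesis using t2 by (simp add: t_def)
qed

text \<open>
  Reducing the cubic modulo the quadratic equation of \<open>opt_left\<close> leaves a linear expression with a
  small slope, for which the bounds on \<open>opt_left\<close> suffice.
\<close>

lemma left_cost_opt_eq: "left_cost opt_left = (317 - 318 * opt_left) / 14850"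
proof -
  have "left_cost opt_left - ((317 - 318 * opt_left) / 14850)
      = (22/25 * opt_left - (41/25 - 22/25 * 41/33)) * (opt_left\<^sup>2 - (41/33 * opt_left - 37/99))"
    by (simp add: left_cost_def field_simps power3_eq_cube power2_eq_square)
  then show ?thesis by (simp add: opt_left_eq)
qed

lemma left_cost_opt_bounds:
  "56815 / 10^7 < left_cost opt_left" "left_cost opt_left < 56825 / 10^7"
  unfolding left_cost_opt_eq using opt_left_bounds by auto

lemma distortion_opt:
  "distortion Pmix {opt_left, opt_right} = ennreal (left_cost opt_left)"
  unfolding split_cost_opt_eq[symmetric]
proof (rule distortion_split(1))
  show "opt_left \<le> opt_right" "4/3 \<le> opt_left + opt_right" "opt_left + opt_right \<le> 2"
    using opt_left_bounds opt_right_bounds by auto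
qed

text \<open>
  In the main case both excess terms are nonnegative. The third root \<open>41/22 - 2 * opt_left\<close> of
  \<open>left_cost_gap\<close> is about \<open>0.4006\<close>, below \<open>a > 1/2\<close>; and a midpoint below \<open>1\<close> means
  \<open>(b - a) / 2 < 1 - a\<close>. Both vanish only at the optimal pair.
\<close>

lemma distortion_gt_opt:
  assumes "a \<le> b" "(a, b) \<noteq> (opt_left, opt_right)"
  shows "distortion Pmix {opt_left, opt_right} < distortion Pmix {a, b}"
proof (cases "a + b \<le> 4/3 \<or> 2 \<le> a + b \<or> a \<le> 1/2")
  case True
  have "ennreal (left_cost opt_left) < ennreal (11/1200)"
    using left_cost_opt_bounds by (intro ennreal_lessI) auto
  also have "\<dots> \<le> distortion Pmix {a, b}"
    using assms True by (intro distortion_unsplit)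
  finally show ?thesis by (simp add: distortion_opt)
next
  case False
  define A where "A = 22/25 * (a - opt_left)\<^sup>2 * (a - (41/22 - 2 * opt_left))"
  define B where "B = 297/50 * ((b - a) / 2 - (1 - a) / 3)\<^sup>2 * (4 * (1 - a) / 3 - (b - a) / 2)"
  have factors: "0 < a - (41/22 - 2 * opt_left)" "0 < 4 * (1 - a) / 3 - (b - a) / 2"
    using False assms opt_left_bounds by auto
  have nonneg: "0 \<le> A" "0 \<le> B"
    using factors by (auto simp: A_def B_def)
  have "A \<noteq> 0 \<or> B \<noteq> 0"
  proof (rule ccontr)
    assume "\<not> (A \<noteq> 0 \<or> B \<noteq> 0)"
    then have "a = opt_left" "(b - a) / 2 = (1 - a) / 3"
      using factors by (auto simp: A_def B_def)
    then show False using assms by (simp add: opt_right_def field_simps)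
  qed
  then have "left_cost opt_left < split_cost a b"
    using split_cost_eq_left_cost[of a b] left_cost_gap[of a] nonneg
    unfolding A_def[symmetric] B_def[symmetric] by linarith
  then show ?thesis
    using False assms left_cost_opt_bounds by (simp add: distortion_opt distortion_split ennreal_lessI)
qed

text \<open>Allowing \<open>a = b\<close> treats singletons and two-point sets together.\<close>

lemma card_le_2_pair:
  fixes S :: "'a::linorder set"
  assumes "finite S" "1 \<le> card S" "card S \<le> 2"
  obtains a b where "a \<le> b" "S = {a, b}"
proof -
  have ne: "S \<noteq> {}" using assms by auto
  have "{Min S, Max S} = S"
  proof (cases "card S = 2")
    case True
    then obtain x y where "S = {x, y}" by (auto simp: card_2_iff)
    then show ?thesis by (auto simp: min_def max_def)
  next
    case False
    then have "card S = 1" using assms by simp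
    then show ?thesis by (auto simp: card_1_singleton_iff)
  qed
  then show ?thesis using that[of "Min S" "Max S"] assms ne by simp
qed

lemma distortion_ge_opt:
  assumes "finite \<alpha>" "1 \<le> card \<alpha>" "card \<alpha> \<le> 2"
  shows "distortion Pmix {opt_left, opt_right} \<le> distortion Pmix \<alpha>"
    and "distortion Pmix \<alpha> = distortion Pmix {opt_left, opt_right} \<Longrightarrow> \<alpha> = {opt_left, opt_right}"
proof -
  obtain a b where ab: "a \<le> b" "\<alpha> = {a, b}"
    using assms by (rule card_le_2_pair)
  show "distortion Pmix {opt_left, opt_right} \<le> distortion Pmix \<alpha>"
    using distortion_gt_opt[OF ab(1)] unfolding ab(2)
    by (cases "(a, b) = (opt_left, opt_right)") (auto simp: less_imp_le)
  show "\<alpha> = {opt_left, opt_right}" if "distortion Pmix \<alpha> = distortion Pmix {opt_left, opt_right}"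
    using distortion_gt_opt[OF ab(1)] that unfolding ab(2)
    by (cases "(a, b) = (opt_left, opt_right)") auto
qed

lemma opt_less: "opt_left < opt_right"
  using opt_left_bounds opt_right_bounds by simp

lemma quantization_error_Pmix:
  "quantization_error 2 Pmix = ennreal (left_cost opt_left)"
  unfolding quantization_error_def distortion_opt[symmetric]
  using opt_less by (intro antisym INF_lower INF_greatest) (auto intro: distortion_ge_opt)

lemma optimal_set_iff: "optimal_set_of_means 2 Pmix \<alpha> \<longleftrightarrow> \<alpha> = {opt_left, opt_right}"
  unfolding optimal_set_of_means_def quantization_error_Pmix distortion_opt[symmetric]
  using opt_less distortion_ge_opt(2)[of \<alpha>] by auto

theorem proposition3p4p1:
  shows "(\<exists>a1 a2 :: real. a1 < a2
            \<and> (\<forall>\<alpha>. optimal_set_of_means 2 Pmix \<alpha> \<longleftrightarrow> \<alpha> = {a1, a2})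
            \<and> round (10 ^ 6 * a1) = 731517
            \<and> round (10 ^ 6 * a2) = 910506)
       \<and> quantization_error 2 Pmix < \<infinity>
       \<and> round (10 ^ 6 * enn2real (quantization_error 2 Pmix)) = 5682"
proof (intro conjI)
  show "\<exists>a1 a2 :: real. a1 < a2
      \<and> (\<forall>\<alpha>. optimal_set_of_means 2 Pmix \<alpha> \<longleftrightarrow> \<alpha> = {a1, a2})
      \<and> round (10 ^ 6 * a1) = 731517
      \<and> round (10 ^ 6 * a2) = 910506"
  proof (rule exI[of _ opt_left], rule exI[of _ opt_right], intro conjI)
    show "opt_left < opt_right" by (rule opt_less)
    show "\<forall>\<alpha>. optimal_set_of_means 2 Pmix \<alpha> \<longleftrightarrow> \<alpha> = {opt_left, opt_right}"
      by (simp add: optimal_set_iff)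
    show "round (10 ^ 6 * opt_left) = 731517"
      using opt_left_bounds by (intro round_unique) auto
    show "round (10 ^ 6 * opt_right) = 910506"
      using opt_right_bounds by (intro round_unique) auto
  qed
  show "quantization_error 2 Pmix < \<infinity>"
    by (simp add: quantization_error_Pmix)
  show "round (10 ^ 6 * enn2real (quantization_error 2 Pmix)) = 5682"
    using left_cost_opt_bounds by (intro round_unique) (auto simp: quantization_error_Pmix)
qed

end
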